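(* Let $f:\mathbb{R}^n\to\mathbb{R}$ be $L$-smooth and $\mu$-strongly convex ($0<\mu\le L$), let $x^*$ be its minimizer and $f^*=f(x^* )$, and let $\widetilde\nabla f$ satisfy the composite noise condition with parameters $\alpha\in[0,1/3]$ and $\delta\ge0$. Let $x^0\in\mathbb{R}^n$, $R=\|x^0-x^*\|_2$, and $$\gamma^*=\min\left\{\log_{\mu/(2L)}(3\alpha),\tfrac12\right\}.$$ Then for every $N$ the point $x^N$ generated by the algorithm RE-AGM with parameters $(L,\mu,x^0,\alpha)$ satisfies $$f(x^N)-f^*\le\left(1-\frac1{150}\left(\frac{\mu}{2L}\right)^{1-\gamma^*}\right)^N\left(f(x^0)-f^*+\frac\mu4R^2\right)+\left(\left(\frac{2L}{\mu}\right)^{\gamma^*}+5\right)\frac{\delta^2}{\mu}$$ and $$f(x^N)-f^*\le\left(1-\frac1{300}\left(\frac{\mu}{L}\right)^{1-\gamma^*}\right)^N\left(f(x^0)-f^*+\frac\mu4R^2\right)+\left(2\left(\frac{L}{\mu}\right)^{\gamma^*}+5\right)\frac{\delta^2}{\mu}.$$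
   Context: $\|\cdot\|_2$ is the Euclidean norm; $f$ is differentiable. $L$-smooth: $f(y)\le f(x)+\langle\nabla f(x),y-x\rangle+\frac L2\|x-y\|_2^2$ for all $x,y$. $\mu$-strongly convex: $f(x)+\langle\nabla f(x),y-x\rangle+\frac\mu2\|x-y\|_2^2\le f(y)$ for all $x,y$. Composite noise condition: $\|\widetilde\nabla f(x)-\nabla f(x)\|_2\le\alpha\|\nabla f(x)\|_2+\delta$ for all $x\in\mathbb{R}^n$. Convention: $\log_{\mu/(2L)}0=+\infty$. Algorithm RE-AGM with parameters $(L,\mu,x^0,\alpha)$: put $h=\frac1{4L}\left(\frac{1-\alpha}{1+\alpha}\right)^{3/2}$, $\widehat L=8\frac{1+\alpha}{(1-\alpha)^3}L$, $\gamma^*=\min\{\log_{\mu/(2L)}(3\alpha),\frac12\}$, $s=\left(1+\frac14\left(\frac\mu{2L}\right)^{\gamma^*}\right)(1+\alpha)^2+2\alpha^2$, $m=\left(1-\frac14\left(\frac\mu{2L}\right)^{\gamma^*}\right)(1-\alpha)^2-2\alpha^2$, $q=\frac{\mu}{2\widehat L}$, and let $\omega=\frac{(m-s)+\sqrt{(s-m)^2+4mq}}{2m}$ be the largest root of $m\omega^2+(s-m)\omega-q=0$. Set $u^0=x^0$ and for $k=0,1,2,\dots$ $$y^k=\frac{\omega u^k+x^k}{1+\omega},\qquad u^{k+1}=(1-\omega)u^k+\omega y^k-\frac{2\omega}{\mu}\widetilde\nabla f(y^k),\qquad x^{k+1}=y^k-h\,\widetilde\nabla f(y^k).$$ *)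

theory Defs
  imports "HOL-Analysis.Analysis"
begin

text \<open>Throughout, \<open>f'\<close> stands for the gradient of \<open>f\<close> and \<open>g\<close> for the inexact gradient
  that the algorithm has access to. The norm of \<open>real ^ 'n\<close> is the Euclidean one.\<close>

definition is_gradient :: "(real ^ 'n \<Rightarrow> real) \<Rightarrow> (real ^ 'n \<Rightarrow> real ^ 'n) \<Rightarrow> bool" where
  "is_gradient f f' \<longleftrightarrow> (\<forall>x. GDERIV f x :> f' x)"

definition smooth_with :: "real \<Rightarrow> (real ^ 'n \<Rightarrow> real) \<Rightarrow> (real ^ 'n \<Rightarrow> real ^ 'n) \<Rightarrow> bool" where
  "smooth_with L f f' \<longleftrightarrow>
     (\<forall>x y. f y \<le> f x + f' x \<bullet> (y - x) + L / 2 * (norm (x - y))\<^sup>2)"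

definition strongly_convex_with ::
  "real \<Rightarrow> (real ^ 'n \<Rightarrow> real) \<Rightarrow> (real ^ 'n \<Rightarrow> real ^ 'n) \<Rightarrow> bool" where
  "strongly_convex_with \<mu> f f' \<longleftrightarrow>
     (\<forall>x y. f x + f' x \<bullet> (y - x) + \<mu> / 2 * (norm (x - y))\<^sup>2 \<le> f y)"

definition composite_noise ::
  "real \<Rightarrow> real \<Rightarrow> (real ^ 'n \<Rightarrow> real ^ 'n) \<Rightarrow> (real ^ 'n \<Rightarrow> real ^ 'n) \<Rightarrow> bool" where
  "composite_noise \<alpha> \<delta> f' g \<longleftrightarrow> (\<forall>x. norm (g x - f' x) \<le> \<alpha> * norm (f' x) + \<delta>)"

text \<open>The case distinction implements the convention that the logarithm of \<open>0\<close> to base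
  \<open>\<mu> / (2 * L)\<close> is \<open>+\<infinity>\<close>, so that the minimum is \<open>1 / 2\<close>; in HOL, \<open>log b 0 = 0\<close>.\<close>

definition gamma_star :: "real \<Rightarrow> real \<Rightarrow> real \<Rightarrow> real" where
  "gamma_star L \<mu> \<alpha> =
     (if \<alpha> = 0 then 1 / 2 else min (log (\<mu> / (2 * L)) (3 * \<alpha>)) (1 / 2))"

definition step_size :: "real \<Rightarrow> real \<Rightarrow> real" where
  "step_size L \<alpha> = 1 / (4 * L) * ((1 - \<alpha>) / (1 + \<alpha>)) powr (3 / 2)"

definition L_hat :: "real \<Rightarrow> real \<Rightarrow> real" where
  "L_hat L \<alpha> = 8 * ((1 + \<alpha>) / (1 - \<alpha>) ^ 3) * L"

definition s_coeff :: "real \<Rightarrow> real \<Rightarrow> real \<Rightarrow> real" where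
  "s_coeff L \<mu> \<alpha> =
     (1 + 1 / 4 * (\<mu> / (2 * L)) powr gamma_star L \<mu> \<alpha>) * (1 + \<alpha>)\<^sup>2 + 2 * \<alpha>\<^sup>2"

definition m_coeff :: "real \<Rightarrow> real \<Rightarrow> real \<Rightarrow> real" where
  "m_coeff L \<mu> \<alpha> =
     (1 - 1 / 4 * (\<mu> / (2 * L)) powr gamma_star L \<mu> \<alpha>) * (1 - \<alpha>)\<^sup>2 - 2 * \<alpha>\<^sup>2"

definition q_coeff :: "real \<Rightarrow> real \<Rightarrow> real \<Rightarrow> real" where
  "q_coeff L \<mu> \<alpha> = \<mu> / (2 * L_hat L \<alpha>)"

text \<open>The largest root of \<open>m * w\<^sup>2 + (s - m) * w - q = 0\<close>; note that \<open>m > 0\<close> for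
  \<open>0 \<le> \<alpha> \<le> 1 / 3\<close> and \<open>0 < \<mu> \<le> L\<close>.\<close>

definition omega :: "real \<Rightarrow> real \<Rightarrow> real \<Rightarrow> real" where
  "omega L \<mu> \<alpha> =
     (let s = s_coeff L \<mu> \<alpha>; m = m_coeff L \<mu> \<alpha>; q = q_coeff L \<mu> \<alpha>
      in ((m - s) + sqrt ((s - m)\<^sup>2 + 4 * m * q)) / (2 * m))"

text \<open>\<open>RE_AGM g L \<mu> x0 \<alpha> k\<close> is the pair of the \<open>k\<close>-th iterates \<open>(x, u)\<close>.\<close>

primrec RE_AGM ::
  "(real ^ 'n \<Rightarrow> real ^ 'n) \<Rightarrow> real \<Rightarrow> real \<Rightarrow> real ^ 'n \<Rightarrow> real \<Rightarrow> nat
     \<Rightarrow> (real ^ 'n) \<times> (real ^ 'n)" where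
  "RE_AGM g L \<mu> x0 \<alpha> 0 = (x0, x0)"
| "RE_AGM g L \<mu> x0 \<alpha> (Suc k) =
     (let (x, u) = RE_AGM g L \<mu> x0 \<alpha> k;
          h = step_size L \<alpha>;
          w = omega L \<mu> \<alpha>;
          y = (1 / (1 + w)) *\<^sub>R (w *\<^sub>R u + x)
      in (y - h *\<^sub>R g y,
          (1 - w) *\<^sub>R u + w *\<^sub>R y - (2 * w / \<mu>) *\<^sub>R g y))"

definition RE_AGM_x ::
  "(real ^ 'n \<Rightarrow> real ^ 'n) \<Rightarrow> real \<Rightarrow> real \<Rightarrow> real ^ 'n \<Rightarrow> real \<Rightarrow> nat \<Rightarrow> real ^ 'n" where
  "RE_AGM_x g L \<mu> x0 \<alpha> k = fst (RE_AGM g L \<mu> x0 \<alpha> k)"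

end

(* The potential V = f(x) - f* + mu/4 |u - x*|^2 obeys V' <= (1 - w) V + w C delta^2 / mu. With
   N = |grad f(y)| this reduces to a quadratic inequality in (N, delta) whose coefficients depend on
   theta = w / (mu h), which the equation for w pins down well enough. For alpha <= 11/50 one gets
   C <= 1/beta + 5 with beta = (mu/(2L))^gamma, and that is the claim. For larger alpha the potential
   only satisfies the recursion with C = 11, which is too weak. There the gap A = f(x) - f* is tracked
   separately: it contracts four times as fast as V, up to an inflow w V, so that it inherits the rate
   of V but a noise floor of only (11 + 13)/4 = 6 <= 1/beta + 5. *)
theory Submission
  imports Defs
begin

subsection \<open>One step of the method\<close>

text \<open>With weight \<mu>/4 in V, expanding the distance uses up only half of the strong
  convexity term; the other half absorbs the product of the gradient error with y - x*. In terms of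
  \<theta> the equation for w loses its factor \<mu>/L and reads 4 \<theta> S \<rho> (1 + \<alpha>)
  = (1 - \<alpha>)^3, where S = m w + s - m and \<rho> = 4 L h. So \<theta> is of order 1/S, and
  since S exceeds 11/2 \<alpha>, a large \<alpha> forces a small \<theta>. This is the obstacle: the
  recursion for V needs \<theta> (C - 2) above a constant, while \<beta> reaches 1 at \<alpha> =
  1/3, where only C = 6 is allowed. The threshold 11/50 lies below sqrt(1/2)/3, so up to it \<beta>
  \<le> sqrt(1/2) and 1/\<beta> + 5 > 6.4. The faster contraction of A is bought with the
  Polyak-Lojasiewicz inequality f(y) - f* \<le> N^2/(2\<mu>): a share 4w of f(y) - f* is charged to
  the decrease of order h N^2 made by the gradient step. The charge is at most 4 \<theta> h N^2 in
  all, affordable because \<theta> \<le> 14/100 for large \<alpha>.\<close>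

lemma cross_term_le:
  fixes P Q T a b :: real
  assumes "P > 0" and "Q\<^sup>2 \<le> 4 * P * T"
  shows "Q * (a * b) \<le> P * a\<^sup>2 + T * b\<^sup>2"
proof -
  have "0 \<le> (2 * P * a - Q * b)\<^sup>2 + (4 * P * T - Q\<^sup>2) * b\<^sup>2"
    using assms(2) by simp
  also have "\<dots> = 4 * P * (P * a\<^sup>2 + T * b\<^sup>2 - Q * (a * b))"
    by (simp add: power2_eq_square algebra_simps)
  finally show ?thesis
    using assms(1) by (simp add: zero_le_mult_iff)
qed

text \<open>Young's inequality. The weight \<mu>/4 is what \<open>potential_step\<close> can spare
  in each of its two quadratic terms.\<close>

lemma neg_inner_le:
  fixes e v :: "'a::real_inner"
  assumes "\<mu> > 0"
  shows "- (e \<bullet> v) \<le> \<mu> / 4 * (v \<bullet> v) + (e \<bullet> e) / \<mu>"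
proof -
  have "0 \<le> (1 / \<mu>) * ((e + (\<mu> / 2) *\<^sub>R v) \<bullet> (e + (\<mu> / 2) *\<^sub>R v))"
    using assms by simp
  also have "\<dots> = \<mu> / 4 * (v \<bullet> v) + (e \<bullet> e) / \<mu> + e \<bullet> v"
    using assms by (simp add: inner_simps inner_commute field_simps)
  finally show ?thesis by simp
qed

text \<open>With e = G - g0 the left side is -(1 - c)|g0|^2 - (1 - 2c) g0.e + c|e|^2. As 1 - 2c
  \<ge> 0, the worst error of norm at most E points against g0 with full length, and the right side
  is the value there.\<close>

lemma inexact_descent:
  fixes g0 G :: "'a::real_inner"
  assumes "norm (G - g0) \<le> E" and "c \<le> 1 / 2" and "0 \<le> c"
  shows "- (g0 \<bullet> G) + c * (G \<bullet> G) \<le> - (norm g0)\<^sup>2 + norm g0 * E + c * (norm g0 - E)\<^sup>2"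
proof -
  define e where "e = G - g0"
  have G: "G = g0 + e" by (simp add: e_def)
  have e: "norm e \<le> E" using assms(1) by (simp add: e_def)
  have ee: "e \<bullet> e \<le> E\<^sup>2"
    using power_mono[OF e, of 2] by (simp add: power2_norm_eq_inner)
  have "- (g0 \<bullet> e) \<le> norm g0 * norm e"
    using norm_cauchy_schwarz[of "- g0" e] by simp
  also have "\<dots> \<le> norm g0 * E" using e by (simp add: mult_left_mono)
  finally have "(1 - 2 * c) * (- (g0 \<bullet> e)) \<le> (1 - 2 * c) * (norm g0 * E)"
    using assms(2) by (intro mult_left_mono) auto
  moreover have "c * (e \<bullet> e) \<le> c * E\<^sup>2"
    using ee assms(3) by (intro mult_left_mono) auto
  moreover have "- (g0 \<bullet> G) + c * (G \<bullet> G)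
      = - (norm g0)\<^sup>2 + c * (norm g0)\<^sup>2 + (1 - 2 * c) * (- (g0 \<bullet> e)) + c * (e \<bullet> e)"
    unfolding G power2_norm_eq_inner by (simp add: inner_simps inner_commute algebra_simps)
  ultimately show ?thesis by (simp add: power2_diff algebra_simps)
qed

section \<open>One step in abstract form, for a gradient error of norm at most E\<close>

context
  fixes x u y g0 G xs :: "'a::real_inner"
    and fx fy fs fp L \<mu> h w \<theta> E :: real
  assumes pos: "\<mu> > 0" "h > 0" "0 \<le> w" "w \<le> 1" "L > 0"
    and y: "y = (1 / (1 + w)) *\<^sub>R (w *\<^sub>R u + x)"
    and \<theta>: "w = \<theta> * \<mu> * h"
    and noise: "norm (G - g0) \<le> E"
    and descent: "fp \<le> fy - h * (g0 \<bullet> G) + L / 2 * (h\<^sup>2 * (G \<bullet> G))"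
    and sc_x: "fy + g0 \<bullet> (x - y) + \<mu> / 2 * (norm (x - y))\<^sup>2 \<le> fx"
    and sc_min: "fy + g0 \<bullet> (xs - y) + \<mu> / 2 * (norm (xs - y))\<^sup>2 \<le> fs"
begin

lemma x_eq: "x = y - w *\<^sub>R (u - y)"
proof -
  have "(1 + w) *\<^sub>R y = w *\<^sub>R u + x" using y pos by simp
  then show ?thesis by (simp add: algebra_simps)
qed

text \<open>Strong convexity at y is used towards x with weight 1 - w and towards xs with weight w;
  the inner products with g0 in the sum match those in the expanded distance. Only products of e = G
  - g0 with u - y and y - xs remain, and Young's inequality trades them for |e|^2/\<mu> and
  quadratic terms that are available.\<close>

lemma potential_step:
  assumes c: "L * h / 2 + w * \<theta> \<le> 1 / 2"
  shows "fp - fs + \<mu> / 4 * (norm ((1 - w) *\<^sub>R u + w *\<^sub>R y - (2 * w / \<mu>) *\<^sub>R G - xs))\<^sup>2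
    \<le> (1 - w) * (fx - fs + \<mu> / 4 * (norm (u - xs))\<^sup>2)
      + h * (- (norm g0)\<^sup>2 + norm g0 * E + (L * h / 2 + w * \<theta>) * (norm g0 - E)\<^sup>2
        + 2 * \<theta> * E\<^sup>2)"
proof -
  define a where "a = u - y"
  define v where "v = y - xs"
  define e where "e = G - g0"
  define c where "c = L * h / 2 + w * \<theta>"
  have \<theta>0: "\<theta> \<ge> 0" using \<theta> pos by (metis not_le zero_le_mult_iff)
  have x: "x - y = - (w *\<^sub>R a)" using x_eq by (simp add: a_def)
  have hc: "h * (- (g0 \<bullet> G) + c * (G \<bullet> G))
      \<le> h * (- (norm g0)\<^sup>2 + norm g0 * E + c * (norm g0 - E)\<^sup>2)"
    using inexact_descent[OF noise, of c] assms pos \<theta>0 by (intro mult_left_mono) (auto simp: c_def)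
  have ee: "e \<bullet> e \<le> E\<^sup>2"
    using power_mono[OF noise, of 2] by (simp add: power2_norm_eq_inner e_def)
  have "0 \<le> \<mu> / 2 * (norm (x - y))\<^sup>2" using pos by simp
  then have "fy - w * (g0 \<bullet> a) \<le> fx" using sc_x unfolding x by simp
  then have "(1 - w) * (fy - w * (g0 \<bullet> a)) \<le> (1 - w) * fx"
    using pos by (intro mult_left_mono) auto
  then have 1: "(1 - w) * fy - w * (1 - w) * (g0 \<bullet> a) \<le> (1 - w) * fx"
    by (simp add: algebra_simps)
  have "xs - y = - v" by (simp add: v_def)
  then have "w * (fy - g0 \<bullet> v + \<mu> / 2 * (v \<bullet> v)) \<le> w * fs"
    using sc_min pos by (intro mult_left_mono) (auto simp: power2_norm_eq_inner)
  then have 2: "w * fy - w * (g0 \<bullet> v) + w * \<mu> / 2 * (v \<bullet> v) \<le> w * fs"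
    by (simp add: algebra_simps)
  have 3: "w * (1 - w) * (- (e \<bullet> a)) \<le> w * (1 - w) * (\<mu> / 4 * (a \<bullet> a) + (e \<bullet> e) / \<mu>)"
    using neg_inner_le[of \<mu> e a] pos by (intro mult_left_mono) auto
  have 4: "w * (- (e \<bullet> v)) \<le> w * (\<mu> / 4 * (v \<bullet> v) + (e \<bullet> e) / \<mu>)"
    using neg_inner_le[of \<mu> e v] pos by (intro mult_left_mono) auto
  have wh: "w / \<mu> = h * \<theta>" using \<theta> pos by simp
  have "w * (1 - w) * ((e \<bullet> e) / \<mu>) \<le> w * 1 * ((e \<bullet> e) / \<mu>)"
    using pos by (intro mult_right_mono mult_left_mono) auto
  then have "w * (1 - w) * ((e \<bullet> e) / \<mu>) + w * ((e \<bullet> e) / \<mu>) \<le> 2 * w * ((e \<bullet> e) / \<mu>)"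
    by linarith
  also have "\<dots> = 2 * (h * \<theta>) * (e \<bullet> e)"
    unfolding wh[symmetric] by simp
  also have "\<dots> \<le> 2 * (h * \<theta>) * E\<^sup>2"
    using ee pos \<theta>0 by (intro mult_left_mono) auto
  finally have 5: "w * (1 - w) * ((e \<bullet> e) / \<mu>) + w * ((e \<bullet> e) / \<mu>) \<le> 2 * (h * \<theta>) * E\<^sup>2" .
  have up: "(1 - w) *\<^sub>R u + w *\<^sub>R y - (2 * w / \<mu>) *\<^sub>R G - xs
      = ((1 - w) *\<^sub>R a + v) - (2 * w / \<mu>) *\<^sub>R G"
    by (simp add: a_def v_def algebra_simps)
  have sq: "(norm (p - (2 * w / \<mu>) *\<^sub>R G))\<^sup>2 = p \<bullet> p - 4 * w / \<mu> * (G \<bullet> p) + 4 * w\<^sup>2 / \<mu>\<^sup>2 * (G \<bullet> G)"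
    for p using pos unfolding power2_norm_eq_inner
    by (simp add: inner_simps inner_commute power2_eq_square algebra_simps)
  have "\<mu> / 4 * (norm (((1 - w) *\<^sub>R a + v) - (2 * w / \<mu>) *\<^sub>R G))\<^sup>2
      = \<mu> / 4 * (((1 - w) *\<^sub>R a + v) \<bullet> ((1 - w) *\<^sub>R a + v)) - w * (G \<bullet> ((1 - w) *\<^sub>R a + v))
        + w\<^sup>2 / \<mu> * (G \<bullet> G)"
    unfolding sq using pos by (simp add: field_simps power2_eq_square)
  \<comment> \<open>From |(1 - w) a + v|^2 = (1 - w)|a + v|^2 + w|v|^2 - w(1 - w)|a|^2. The negative
    term in a pays for the Young term of e.a; the w \<mu>/2 |v|^2 of strong convexity pays for the w
    \<mu>/4 |v|^2 here and for the Young term of e.v.\<close>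
  also have "\<dots> = (1 - w) * (\<mu> / 4 * ((a + v) \<bullet> (a + v))) + w * \<mu> / 4 * (v \<bullet> v)
      - \<mu> / 4 * w * (1 - w) * (a \<bullet> a) - w * (1 - w) * (g0 \<bullet> a) - w * (g0 \<bullet> v)
      + w * (1 - w) * (- (e \<bullet> a)) + w * (- (e \<bullet> v)) + w\<^sup>2 / \<mu> * (G \<bullet> G)"
    by (simp add: e_def inner_simps inner_commute algebra_simps power2_eq_square
        add_divide_distrib diff_divide_distrib)
  also have "w\<^sup>2 / \<mu> = h * (w * \<theta>)" using \<theta> pos by (simp add: power2_eq_square)
  finally have main: "\<mu> / 4 * (norm (((1 - w) *\<^sub>R a + v) - (2 * w / \<mu>) *\<^sub>R G))\<^sup>2
     = (1 - w) * (\<mu> / 4 * ((a + v) \<bullet> (a + v))) + w * \<mu> / 4 * (v \<bullet> v)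
      - \<mu> / 4 * w * (1 - w) * (a \<bullet> a) - w * (1 - w) * (g0 \<bullet> a) - w * (g0 \<bullet> v)
      + w * (1 - w) * (- (e \<bullet> a)) + w * (- (e \<bullet> v)) + h * (w * \<theta>) * (G \<bullet> G)" .
  have av: "(a + v) \<bullet> (a + v) = (norm (u - xs))\<^sup>2"
    by (simp add: a_def v_def power2_norm_eq_inner)
  have hG: "h * (- (g0 \<bullet> G) + c * (G \<bullet> G))
      = - (h * (g0 \<bullet> G)) + L / 2 * (h\<^sup>2 * (G \<bullet> G)) + h * (w * \<theta>) * (G \<bullet> G)"
    by (simp add: c_def algebra_simps power2_eq_square)
  show ?thesis
    unfolding up main av c_def[symmetric] using descent hc 1 2 3 4 5 hG
    unfolding distrib_left left_diff_distrib by argo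
qed

text \<open>There are two bounds for f(y) - f*: one through f(x) and strong convexity, which brings
  in w g0.(u - y), and one through the gradient norm alone. They are combined with weights 1 - 4w
  and 4w. The product g0.(u - y) is what couples the gap to the distance part of the
  potential.\<close>

lemma gap_step:
  assumes c: "L * h / 2 \<le> 1 / 2" and w: "4 * w \<le> 1"
    and min: "fs + \<mu> / 2 * (norm (y - xs))\<^sup>2 \<le> fy" "fs \<le> fx"
  shows "fp - fs \<le> (1 - 4 * w) * (fx - fs) + w * (fx - fs + \<mu> / 4 * (norm (u - xs))\<^sup>2)
      + h * (- (norm g0)\<^sup>2 + norm g0 * E + (L * h / 2) * (norm g0 - E)\<^sup>2
        + 4 * \<theta> * (norm g0)\<^sup>2)"
proof -
  define a where "a = u - y"
  define v where "v = y - xs"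
  define B where "B = \<mu> / 4 * (norm (u - xs))\<^sup>2"
  define N where "N = norm g0"
  have x: "x - y = - (w *\<^sub>R a)" using x_eq by (simp add: a_def)
  have v': "xs - y = - v" by (simp add: v_def)
  have hc: "h * (- (g0 \<bullet> G) + (L * h / 2) * (G \<bullet> G))
      \<le> h * (- N\<^sup>2 + N * E + (L * h / 2) * (N - E)\<^sup>2)"
    using inexact_descent[OF noise c] pos unfolding N_def by (intro mult_left_mono) auto
  have hG: "h * (- (g0 \<bullet> G) + (L * h / 2) * (G \<bullet> G)) = - (h * (g0 \<bullet> G)) + L / 2 * (h\<^sup>2 * (G \<bullet> G))"
    by (simp add: algebra_simps power2_eq_square)
  have gv: "g0 \<bullet> v \<le> N * norm v" unfolding N_def by (rule norm_cauchy_schwarz)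
  have sc: "fy - g0 \<bullet> v + \<mu> / 2 * (norm v)\<^sup>2 \<le> fs"
    using sc_min unfolding v' by simp
  have "fy - fs \<le> N * norm v - \<mu> / 2 * (norm v)\<^sup>2" using gv sc by simp
  also have "\<dots> \<le> N\<^sup>2 / (2 * \<mu>)"
    using cross_term_le[of "\<mu> / 2" 1 "1 / (2 * \<mu>)" "norm v" N] pos by (simp add: mult.commute)
  finally have PL: "fy - fs \<le> N\<^sup>2 / (2 * \<mu>)" .
  \<comment> \<open>Quadratic growth from the minimizer and strong convexity at y contribute \<mu>/2
    each.\<close>
  have "\<mu> * (norm v)\<^sup>2 \<le> N * norm v"
    using gv sc min(1) by (simp add: v_def)
  then have vN: "norm v \<le> N / \<mu>"
    using pos N_def by (cases "v = 0") (auto simp: power2_eq_square field_simps)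
  have "norm a \<le> norm (u - xs) + norm v"
    using norm_triangle_ineq4[of "u - xs" v] by (simp add: a_def v_def)
  then have "norm a \<le> norm (u - xs) + N / \<mu>" using vN by simp
  then have "N * norm a \<le> N * norm (u - xs) + N\<^sup>2 / \<mu>"
    using mult_left_mono[of "norm a" "norm (u - xs) + N / \<mu>" N] by (simp add: N_def algebra_simps power2_eq_square)
  moreover have "N * norm (u - xs) \<le> N\<^sup>2 / \<mu> + B"
    using cross_term_le[of "1 / \<mu>" 1 "\<mu> / 4" N "norm (u - xs)"] pos by (simp add: B_def)
  moreover have "g0 \<bullet> a \<le> N * norm a" unfolding N_def by (rule norm_cauchy_schwarz)
  ultimately have ga: "g0 \<bullet> a \<le> 2 * (N\<^sup>2 / \<mu>) + B" by simp
  have "0 \<le> \<mu> / 2 * (norm (x - y))\<^sup>2" using pos by simp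
  then have "fy - w * (g0 \<bullet> a) \<le> fx" using sc_x unfolding x by simp
  then have "fy - fs \<le> (fx - fs) + w * (2 * (N\<^sup>2 / \<mu>) + B)"
    using mult_left_mono[OF ga, of w] pos by simp
  \<comment> \<open>Each of the two weighted bounds costs at most 2 h \<theta> N^2, together the
    term 4 \<theta> N^2 of the claim.\<close>
  then have "(1 - 4 * w) * (fy - fs) \<le> (1 - 4 * w) * ((fx - fs) + w * (2 * (N\<^sup>2 / \<mu>) + B))"
    using w by (intro mult_left_mono) auto
  moreover have "(1 - 4 * w) * (w * (2 * (N\<^sup>2 / \<mu>) + B)) \<le> 1 * (w * (2 * (N\<^sup>2 / \<mu>) + B))"
    using pos by (intro mult_right_mono mult_nonneg_nonneg add_nonneg_nonneg) (auto simp: B_def)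
  moreover have "(4 * w) * (fy - fs) \<le> (4 * w) * (N\<^sup>2 / (2 * \<mu>))"
    using PL pos by (intro mult_left_mono) auto
  moreover have "(4 * w) * (N\<^sup>2 / (2 * \<mu>)) = 2 * (h * \<theta>) * N\<^sup>2" "w * (N\<^sup>2 / \<mu>) = h * \<theta> * N\<^sup>2"
    using \<theta> pos by auto
  moreover have "0 \<le> w * (fx - fs)" using pos min(2) by simp
  moreover have "fp \<le> fy + h * (- N\<^sup>2 + N * E + (L * h / 2) * (N - E)\<^sup>2)"
    using descent hc hG by linarith
  moreover have "h * (- N\<^sup>2 + N * E + (L * h / 2) * (N - E)\<^sup>2 + 4 * \<theta> * N\<^sup>2)
      = h * (- N\<^sup>2 + N * E + (L * h / 2) * (N - E)\<^sup>2) + 4 * (h * \<theta> * N\<^sup>2)"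
    by (simp add: algebra_simps)
  ultimately show ?thesis
    unfolding N_def[symmetric] B_def[symmetric] distrib_left left_diff_distrib by argo
qed

end

subsection \<open>Quadratic forms in the gradient norm and the noise level\<close>

text \<open>Expanded, the left side is -P N^2 + Q N \<delta> + (c + p) \<delta>^2, with P the
  positive quantity of the first assumption and Q the number squared in the second; the rest is the
  discriminant criterion. The potential uses p = 2\<theta>, r = 0, the gap p = 0, r =
  4\<theta>.\<close>

lemma noise_form_le:
  fixes \<alpha> c p r T N \<delta> :: real
  assumes "0 < 1 - \<alpha> - c * (1 - \<alpha>)\<^sup>2 - p * \<alpha>\<^sup>2 - r"
    and "(1 - 2 * c * (1 - \<alpha>) + 2 * p * \<alpha>)\<^sup>2
      \<le> 4 * (1 - \<alpha> - c * (1 - \<alpha>)\<^sup>2 - p * \<alpha>\<^sup>2 - r) * (T - c - p)"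
  shows "- N\<^sup>2 + N * (\<alpha> * N + \<delta>) + c * (N - (\<alpha> * N + \<delta>))\<^sup>2 + p * (\<alpha> * N + \<delta>)\<^sup>2 + r * N\<^sup>2 \<le> T * \<delta>\<^sup>2"
  using cross_term_le[OF assms, of N \<delta>] by (simp add: power2_eq_square algebra_simps)

lemma small_noise_form_le:
  fixes \<alpha> \<theta> C c N \<delta> :: real
  assumes \<alpha>: "0 \<le> \<alpha>" "\<alpha> \<le> 11 / 50" and \<theta>: "12 / 100 \<le> \<theta>" "22 * (\<alpha> * \<theta>) \<le> 1 - \<alpha>"
    and C: "64 / 10 \<le> C" and c: "c \<le> (1 - 2 * \<alpha>) / 4"
  shows "- N\<^sup>2 + N * (\<alpha> * N + \<delta>) + c * (N - (\<alpha> * N + \<delta>))\<^sup>2 + 2 * \<theta> * (\<alpha> * N + \<delta>)\<^sup>2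
    \<le> \<theta> * C * \<delta>\<^sup>2"
proof -
  \<comment> \<open>The form increases with c, so the discriminant is examined at the upper bound of
    c only.\<close>
  define c' where "c' = (1 - 2 * \<alpha>) / 4"
  define P where "P = 1 - \<alpha> - c' * (1 - \<alpha>)\<^sup>2 - (2 * \<theta>) * \<alpha>\<^sup>2 - 0"
  define Q where "Q = 1 - 2 * c' * (1 - \<alpha>) + 2 * (2 * \<theta>) * \<alpha>"
  have a2: "\<alpha>\<^sup>2 \<le> 11 / 50 * \<alpha>" using mult_right_mono[OF \<alpha>(2,1)] by (simp add: power2_eq_square)
  have "22 * (\<alpha> * \<theta>) * \<alpha> \<le> 1 * \<alpha>" using \<theta>(2) \<alpha> by (intro mult_right_mono) auto
  then have "\<theta> * \<alpha>\<^sup>2 \<le> 1 / 22 * \<alpha>" by (simp add: power2_eq_square mult_ac)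
  moreover have "P = 3 / 4 - 5 / 4 * \<alpha>\<^sup>2 + \<alpha> ^ 3 / 2 - 2 * (\<theta> * \<alpha>\<^sup>2)"
    by (simp add: P_def c'_def field_simps power2_eq_square power3_eq_cube)
  moreover have "0 \<le> \<alpha> ^ 3" using \<alpha> by simp
  ultimately have P: "66 / 100 \<le> P" using a2 \<alpha> by linarith
  have "Q = 1 / 2 + 3 / 2 * \<alpha> - \<alpha>\<^sup>2 + 4 * (\<alpha> * \<theta>)"
    by (simp add: Q_def c'_def field_simps power2_eq_square)
  then have Q: "Q \<le> 682 / 1000 + 1319 / 1000 * \<alpha>" "0 \<le> Q"
    using \<theta> a2 \<alpha> zero_le_power2[of \<alpha>] mult_nonneg_nonneg[of \<alpha> \<theta>] by argo+
  have T: "277 / 1000 + \<alpha> / 2 \<le> \<theta> * C - c' - 2 * \<theta>"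
  proof -
    have "12 / 100 * (44 / 10) \<le> \<theta> * (C - 2)" using C \<theta>(1) by (intro mult_mono) auto
    then show ?thesis unfolding c'_def by argo
  qed
  have "Q\<^sup>2 \<le> (682 / 1000 + 1319 / 1000 * \<alpha>)\<^sup>2" using Q by (rule power_mono)
  also have "\<dots> \<le> 4 * (66 / 100) * (277 / 1000 + \<alpha> / 2)"
    using a2 \<alpha> by (simp add: power2_eq_square algebra_simps)
  also have "\<dots> \<le> 4 * P * (\<theta> * C - c' - 2 * \<theta>)"
    using P T \<alpha> by (intro mult_mono) auto
  finally have "Q\<^sup>2 \<le> 4 * P * (\<theta> * C - c' - 2 * \<theta>)" .
  then have *: "- N\<^sup>2 + N * (\<alpha> * N + \<delta>) + c' * (N - (\<alpha> * N + \<delta>))\<^sup>2 + 2 * \<theta> * (\<alpha> * N + \<delta>)\<^sup>2 + 0 * N\<^sup>2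
      \<le> (\<theta> * C) * \<delta>\<^sup>2"
    using P by (intro noise_form_le) (auto simp: P_def Q_def)
  have "c * (N - (\<alpha> * N + \<delta>))\<^sup>2 \<le> c' * (N - (\<alpha> * N + \<delta>))\<^sup>2"
    using c by (intro mult_right_mono) (auto simp: c'_def)
  with * show ?thesis by simp
qed

text \<open>Since \<theta> may be as small as 62/1000, C has to make up for it in \<theta> (C - 2).
  With the bounds on P and Q used here the discriminant test fails for C = 10 and holds for C =
  11.\<close>

lemma large_noise_form_le:
  fixes \<alpha> \<theta> c N \<delta> :: real
  assumes \<alpha>: "0 \<le> \<alpha>" "\<alpha> \<le> 1 / 3" and \<theta>: "62 / 1000 \<le> \<theta>" "\<alpha> * \<theta> \<le> 31 / 1000"
    and c: "c \<le> 7 / 100"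
  shows "- N\<^sup>2 + N * (\<alpha> * N + \<delta>) + c * (N - (\<alpha> * N + \<delta>))\<^sup>2 + 2 * \<theta> * (\<alpha> * N + \<delta>)\<^sup>2
    \<le> \<theta> * 11 * \<delta>\<^sup>2"
proof -
  define c' :: real where "c' = 7 / 100"
  define P where "P = 1 - \<alpha> - c' * (1 - \<alpha>)\<^sup>2 - (2 * \<theta>) * \<alpha>\<^sup>2 - 0"
  define Q where "Q = 1 - 2 * c' * (1 - \<alpha>) + 2 * (2 * \<theta>) * \<alpha>"
  have a2: "\<alpha>\<^sup>2 \<le> 1 / 3 * \<alpha>" using mult_right_mono[OF \<alpha>(2,1)] by (simp add: power2_eq_square)
  have "\<theta> * \<alpha>\<^sup>2 \<le> 31 / 1000 * \<alpha>"
    using mult_right_mono[OF \<theta>(2), of \<alpha>] \<alpha> by (simp add: power2_eq_square algebra_simps)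
  moreover have "P = 93 / 100 - 86 / 100 * \<alpha> - 7 / 100 * \<alpha>\<^sup>2 - 2 * (\<theta> * \<alpha>\<^sup>2)"
    by (simp add: P_def c'_def field_simps power2_eq_square)
  ultimately have P: "61 / 100 \<le> P" using a2 \<alpha> by simp
  have "Q = 86 / 100 + 14 / 100 * \<alpha> + 4 * (\<alpha> * \<theta>)"
    by (simp add: Q_def c'_def field_simps)
  then have Q: "Q \<le> 1031 / 1000" "0 \<le> Q" using \<theta> \<alpha> by auto
  have T: "488 / 1000 \<le> \<theta> * 11 - c' - 2 * \<theta>" using \<theta> by (simp add: c'_def)
  have "Q\<^sup>2 \<le> (1031 / 1000)\<^sup>2" using Q by (rule power_mono)
  also have "\<dots> \<le> 4 * (61 / 100) * (488 / 1000)" by (simp add: power2_eq_square)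
  also have "\<dots> \<le> 4 * P * (\<theta> * 11 - c' - 2 * \<theta>)"
    using P T by (intro mult_mono) auto
  finally have "Q\<^sup>2 \<le> 4 * P * (\<theta> * 11 - c' - 2 * \<theta>)" .
  then have *: "- N\<^sup>2 + N * (\<alpha> * N + \<delta>) + c' * (N - (\<alpha> * N + \<delta>))\<^sup>2 + 2 * \<theta> * (\<alpha> * N + \<delta>)\<^sup>2 + 0 * N\<^sup>2
      \<le> (\<theta> * 11) * \<delta>\<^sup>2"
    using P by (intro noise_form_le) (auto simp: P_def Q_def)
  have "c * (N - (\<alpha> * N + \<delta>))\<^sup>2 \<le> c' * (N - (\<alpha> * N + \<delta>))\<^sup>2"
    using c by (intro mult_right_mono) (auto simp: c'_def)
  with * show ?thesis by simp
qed

text \<open>The term 4 \<theta> N^2 uses up much of the negative N^2 term, so \<alpha> and \<theta>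
  must not be large together: at \<alpha> = 1/3, \<theta> = 14/100, c = 7/100 the discriminant test
  fails. The joint bound on \<alpha> and \<theta> excludes this corner.\<close>

lemma large_noise_gap_form_le:
  fixes \<alpha> \<theta> c N \<delta> :: real
  assumes \<alpha>: "0 \<le> \<alpha>" "\<alpha> \<le> 1 / 3" and \<theta>: "62 / 1000 \<le> \<theta>" "\<theta> \<le> 14 / 100"
    and \<alpha>\<theta>: "\<alpha> + 16 / 10 * \<theta> \<le> 452 / 1000"
    and c: "c \<le> 7 / 100"
  shows "- N\<^sup>2 + N * (\<alpha> * N + \<delta>) + c * (N - (\<alpha> * N + \<delta>))\<^sup>2 + 4 * \<theta> * N\<^sup>2 \<le> \<theta> * 13 * \<delta>\<^sup>2"
proof -
  define c' :: real where "c' = 7 / 100"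
  define P where "P = 1 - \<alpha> - c' * (1 - \<alpha>)\<^sup>2 - 0 * \<alpha>\<^sup>2 - 4 * \<theta>"
  define Q where "Q = 1 - 2 * c' * (1 - \<alpha>) + 2 * 0 * \<alpha>"
  \<comment> \<open>A lower bound for P in \<theta> alone, obtained by eliminating \<alpha> with the
    joint bound.\<close>
  define p where "p = 53 / 100 - 26 / 10 * \<theta>"
  have a2: "\<alpha>\<^sup>2 \<le> 1 / 3 * \<alpha>" using mult_right_mono[OF \<alpha>(2,1)] by (simp add: power2_eq_square)
  have "P = 93 / 100 - 86 / 100 * \<alpha> - 7 / 100 * \<alpha>\<^sup>2 - 4 * \<theta>"
    by (simp add: P_def c'_def field_simps power2_eq_square)
  then have P: "p \<le> P" using a2 \<alpha> \<alpha>\<theta> \<theta> by (simp add: p_def)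
  have p: "0 < p" using \<theta> by (simp add: p_def)
  have "Q = 86 / 100 + 14 / 100 * \<alpha>" by (simp add: Q_def c'_def field_simps)
  then have Q: "Q \<le> 907 / 1000" "0 \<le> Q" using \<alpha> by auto
  \<comment> \<open>The remaining condition is concave in \<theta>, so \<theta>^2 may be replaced by
    its chord over the range of \<theta>.\<close>
  have "0 \<le> (\<theta> - 62 / 1000) * (14 / 100 - \<theta>)" using \<theta> by simp
  also have "\<dots> = 202 / 1000 * \<theta> - 868 / 100000 - \<theta> * \<theta>" by (simp add: field_simps)
  finally have th2: "\<theta> * \<theta> \<le> 202 / 1000 * \<theta> - 868 / 100000" by simp
  have "Q\<^sup>2 \<le> (907 / 1000)\<^sup>2" using Q by (rule power_mono)
  also have "\<dots> \<le> 4 * p * (\<theta> * 13 - c' - 0)"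
    using th2 \<theta> by (simp add: p_def c'_def power2_eq_square algebra_simps)
  also have "\<dots> \<le> 4 * P * (\<theta> * 13 - c' - 0)"
    using P p \<theta> by (intro mult_mono) (auto simp: c'_def)
  finally have "Q\<^sup>2 \<le> 4 * P * (\<theta> * 13 - c' - 0)" .
  then have *: "- N\<^sup>2 + N * (\<alpha> * N + \<delta>) + c' * (N - (\<alpha> * N + \<delta>))\<^sup>2 + 0 * (\<alpha> * N + \<delta>)\<^sup>2 + (4 * \<theta>) * N\<^sup>2
      \<le> (\<theta> * 13) * \<delta>\<^sup>2"
    using P p by (intro noise_form_le) (auto simp: P_def Q_def)
  have "c * (N - (\<alpha> * N + \<delta>))\<^sup>2 \<le> c' * (N - (\<alpha> * N + \<delta>))\<^sup>2"
    using c by (intro mult_right_mono) (auto simp: c'_def)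
  with * show ?thesis by simp
qed

subsection \<open>The parameters of the method\<close>

text \<open>The base is below 1, so powers reverse the order and the minimum of the exponents
  becomes a maximum of powers. In this form \<alpha> = 0 is no longer a special case.\<close>

lemma powr_gamma_star:
  assumes "0 < \<mu>" "\<mu> \<le> L" "0 \<le> \<alpha>"
  shows "(\<mu> / (2 * L)) powr gamma_star L \<mu> \<alpha> = max (3 * \<alpha>) (sqrt (\<mu> / (2 * L)))"
proof -
  define b where "b = \<mu> / (2 * L)"
  have b: "0 < b" "b < 1" using assms by (auto simp: b_def field_simps)
  have half: "b powr (1 / 2) = sqrt b" using b by (simp add: powr_half_sqrt)
  show ?thesis
  proof (cases "\<alpha> = 0")
    case True
    then show ?thesis using half b by (simp add: gamma_star_def b_def)
  next
    case False
    then have log: "b powr log b (3 * \<alpha>) = 3 * \<alpha>" using b assms by (simp add: powr_log_cancel)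
    show ?thesis
    proof (cases "log b (3 * \<alpha>) \<le> 1 / 2")
      case True
      then have "sqrt b \<le> 3 * \<alpha>" using powr_mono'[OF True, of b] half log b by simp
      with True False show ?thesis using log by (simp add: gamma_star_def b_def)
    next
      case F: False
      then have "3 * \<alpha> \<le> sqrt b" using powr_mono'[of "1 / 2" "log b (3 * \<alpha>)" b] half log b by simp
      with F False show ?thesis using half by (simp add: gamma_star_def b_def)
    qed
  qed
qed

text \<open>Polynomial substitutes for the power 3/2. With r = (1 - \<alpha>)/(1 + \<alpha>) and
  \<rho> = r sqrt r, both follow from 1 - \<alpha> \<le> sqrt r \<le> 1/(1 + \<alpha>), which only
  says 1 - \<alpha>^2 \<le> 1.\<close>

lemma powr_three_halves_bounds:
  fixes \<alpha> :: real
  assumes "0 \<le> \<alpha>" "\<alpha> < 1"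
  defines "\<rho> \<equiv> ((1 - \<alpha>) / (1 + \<alpha>)) powr (3 / 2)"
  shows "(1 - \<alpha>)\<^sup>2 \<le> \<rho> * (1 + \<alpha>)" and "\<rho> * (1 + \<alpha>)\<^sup>2 \<le> 1 - \<alpha>"
proof -
  define r where "r = (1 - \<alpha>) / (1 + \<alpha>)"
  have r: "0 < r" using assms by (simp add: r_def)
  have \<rho>: "\<rho> = r * sqrt r"
    using powr_add[of r 1 "1 / 2"] r by (simp add: \<rho>_def r_def[symmetric] powr_half_sqrt)
  have r1: "r * (1 + \<alpha>) = 1 - \<alpha>" using assms by (simp add: r_def)
  have \<alpha>2: "(1 - \<alpha>) * (1 + \<alpha>) \<le> 1" by (simp add: algebra_simps)
  then have "(1 - \<alpha>) * ((1 - \<alpha>) * (1 + \<alpha>)) \<le> (1 - \<alpha>) * 1"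
    using assms by (intro mult_left_mono) auto
  then have "(1 - \<alpha>)\<^sup>2 \<le> r" using assms by (simp add: r_def power2_eq_square field_simps)
  then have lo: "1 - \<alpha> \<le> sqrt r" by (rule real_le_rsqrt)
  have "r * (1 + \<alpha>)\<^sup>2 = (1 - \<alpha>) * (1 + \<alpha>)"
    using r1 by (simp add: power2_eq_square flip: mult.assoc)
  then have "r * (1 + \<alpha>)\<^sup>2 \<le> 1\<^sup>2" using \<alpha>2 by simp
  then have "sqrt (r * (1 + \<alpha>)\<^sup>2) \<le> 1" using real_le_lsqrt by fastforce
  then have up: "sqrt r * (1 + \<alpha>) \<le> 1" using assms by (simp add: real_sqrt_mult)
  show "(1 - \<alpha>)\<^sup>2 \<le> \<rho> * (1 + \<alpha>)"
    using mult_left_mono[OF lo, of "1 - \<alpha>"] assms r1 unfolding \<rho>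
    by (metis mult.assoc mult.commute power2_eq_square diff_ge_0_iff_ge less_imp_le)
  have "\<rho> * (1 + \<alpha>)\<^sup>2 = (r * (1 + \<alpha>)) * (sqrt r * (1 + \<alpha>))"
    by (simp add: \<rho> power2_eq_square algebra_simps)
  also have "\<dots> \<le> (1 - \<alpha>) * 1" unfolding r1 using up assms by (intro mult_left_mono) auto
  finally show "\<rho> * (1 + \<alpha>)\<^sup>2 \<le> 1 - \<alpha>" by simp
qed

lemma quadratic_root:
  fixes m s q :: real
  assumes "m > 0" "q > 0" and "w = ((m - s) + sqrt ((s - m)\<^sup>2 + 4 * m * q)) / (2 * m)"
  shows "w > 0" and "m * w\<^sup>2 + (s - m) * w = q"
proof -
  define D where "D = (s - m)\<^sup>2 + 4 * m * q"
  have w: "2 * m * w = (m - s) + sqrt D" using assms by (simp add: D_def)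
  have "(s - m)\<^sup>2 < D" using assms by (simp add: D_def)
  then have "\<bar>s - m\<bar> < sqrt D" using real_sqrt_less_iff[of "(s - m)\<^sup>2" D] by simp
  then have "0 < 2 * m * w" using w by simp
  then show "w > 0" using assms(1) by (simp add: zero_less_mult_iff)
  have "(2 * m * w + (s - m))\<^sup>2 = D"
    unfolding w using assms by (simp add: D_def)
  then have "4 * m * (m * w\<^sup>2 + (s - m) * w) = 4 * m * q"
    by (simp add: D_def power2_eq_square algebra_simps)
  then show "m * w\<^sup>2 + (s - m) * w = q" using assms(1) by simp
qed

section \<open>Consequences of the root equation, with b = \<mu>/(2L), \<rho> = 4Lh and S = m w + s
  - m\<close>

context
  fixes \<alpha> b \<beta> \<rho> \<theta> w m S :: real
  assumes \<alpha>: "0 \<le> \<alpha>" "\<alpha> \<le> 1 / 3" and b: "0 < b" "b \<le> 1 / 2"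
    and \<beta>: "\<beta> = max (3 * \<alpha>) (sqrt b)"
    and \<rho>: "(1 - \<alpha>)\<^sup>2 \<le> \<rho> * (1 + \<alpha>)" "\<rho> * (1 + \<alpha>)\<^sup>2 \<le> 1 - \<alpha>"
    and \<theta>: "0 < \<theta>" "w = \<theta> * b * \<rho> / 2" and m: "0 \<le> m" "m \<le> 1"
    and S: "S = m * w + 4 * \<alpha> + 4 * \<alpha>\<^sup>2 + \<beta> / 2 * (1 + \<alpha>\<^sup>2)"
    and root: "4 * (\<theta> * S) * (\<rho> * (1 + \<alpha>)) = (1 - \<alpha>) ^ 3"
begin

lemma beta_bounds: "3 * \<alpha> \<le> \<beta>" "b \<le> \<beta>\<^sup>2" "0 < \<beta>" "\<beta> \<le> 1"
  "\<alpha> \<le> 11 / 50 \<Longrightarrow> \<beta> \<le> 7072 / 10000"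
proof -
  have "sqrt b \<le> 7072 / 10000" using b by (intro real_le_lsqrt) (auto simp: power2_eq_square)
  then show "\<beta> \<le> 1" "\<alpha> \<le> 11 / 50 \<Longrightarrow> \<beta> \<le> 7072 / 10000" using \<beta> \<alpha> b by auto
  show "3 * \<alpha> \<le> \<beta>" "0 < \<beta>" using b by (auto simp: \<beta> less_max_iff_disj)
  have "(sqrt b)\<^sup>2 \<le> \<beta>\<^sup>2" using \<beta> b by (intro power_mono) auto
  then show "b \<le> \<beta>\<^sup>2" using b by simp
qed

lemma alpha_sq: "\<alpha>\<^sup>2 \<le> \<alpha> / 3"
  using mult_right_mono[OF \<alpha>(2,1)] by (simp add: power2_eq_square)

lemma rho_bounds: "0 < \<rho>" "\<rho> \<le> 1"
proof -
  have "0 < (1 - \<alpha>)\<^sup>2" using \<alpha> by simp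
  then have "0 < \<rho> * (1 + \<alpha>)" using \<rho>(1) by linarith
  then show p: "0 < \<rho>" using \<alpha> by (simp add: zero_less_mult_iff)
  have "\<rho> * 1 \<le> \<rho> * (1 + \<alpha>)\<^sup>2" using p \<alpha> by (intro mult_left_mono) auto
  then show "\<rho> \<le> 1" using \<rho>(2) \<alpha> by simp
qed

lemma w_pos: "0 < w" using \<theta>(1) rho_bounds b by (simp add: \<theta>(2))

lemma S_eq: "S = m * w + 4 * \<alpha> + 4 * \<alpha>\<^sup>2 + \<beta> / 2 + \<beta> * \<alpha>\<^sup>2 / 2"
  unfolding S by (simp add: algebra_simps)

text \<open>The coefficient 11/2 is 4 from s - m plus 3/2 from \<beta>/2 \<ge> 3\<alpha>/2.\<close>

lemma S_ge: "11 / 2 * \<alpha> + 4 * \<alpha>\<^sup>2 \<le> S" "\<beta> / 2 \<le> S"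
proof -
  have "0 \<le> m * w" using m w_pos by simp
  moreover have "0 \<le> \<beta> * \<alpha>\<^sup>2" using beta_bounds by simp
  ultimately show "11 / 2 * \<alpha> + 4 * \<alpha>\<^sup>2 \<le> S" "\<beta> / 2 \<le> S"
    using S_eq beta_bounds(1) \<alpha> zero_le_power2[of \<alpha>] by linarith+
qed

text \<open>The lower bound on \<rho> (1 + \<alpha>) removes \<rho> from \<open>root\<close> and
  cancels two factors 1 - \<alpha>; the upper bound on \<rho> does the same in
  \<open>theta_S_ge\<close>.\<close>

lemma theta_S_le: "4 * (\<theta> * S) \<le> 1 - \<alpha>"
proof -
  have "0 \<le> S" using S_ge(2) beta_bounds(3) by linarith
  then have "4 * (\<theta> * S) * (1 - \<alpha>)\<^sup>2 \<le> 4 * (\<theta> * S) * (\<rho> * (1 + \<alpha>))"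
    using \<rho>(1) \<theta> by (intro mult_left_mono) auto
  also have "\<dots> = (1 - \<alpha>) * (1 - \<alpha>)\<^sup>2" using root by (simp add: power3_eq_cube power2_eq_square)
  finally show ?thesis using \<alpha> by simp
qed

lemma theta_S_ge: "(1 - \<alpha>)\<^sup>2 * (1 + \<alpha>) \<le> 4 * (\<theta> * S)"
proof -
  have "0 \<le> S" using S_ge(2) beta_bounds(3) by linarith
  have "(1 - \<alpha>) ^ 3 * (1 + \<alpha>) = 4 * (\<theta> * S) * (\<rho> * (1 + \<alpha>)\<^sup>2)"
    unfolding root[symmetric] by (simp add: power2_eq_square)
  also have "\<dots> \<le> 4 * (\<theta> * S) * (1 - \<alpha>)"
    using \<rho>(2) \<theta> \<open>0 \<le> S\<close> by (intro mult_left_mono) auto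
  finally have "(1 - \<alpha>) * ((1 - \<alpha>)\<^sup>2 * (1 + \<alpha>)) \<le> (1 - \<alpha>) * (4 * (\<theta> * S))"
    by (simp add: power3_eq_cube power2_eq_square mult_ac)
  then show ?thesis using \<alpha> by simp
qed

lemma theta_alpha: "4 * \<theta> * (11 / 2 * \<alpha> + 4 * \<alpha>\<^sup>2) \<le> 1 - \<alpha>" "22 * (\<alpha> * \<theta>) \<le> 1 - \<alpha>"
proof -
  have "4 * (\<theta> * (11 / 2 * \<alpha> + 4 * \<alpha>\<^sup>2)) \<le> 4 * (\<theta> * S)" using S_ge(1) \<theta> by simp
  then show "4 * \<theta> * (11 / 2 * \<alpha> + 4 * \<alpha>\<^sup>2) \<le> 1 - \<alpha>" using theta_S_le by simp
  moreover have "0 \<le> \<theta> * \<alpha>\<^sup>2" using \<theta> by simp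
  ultimately show "22 * (\<alpha> * \<theta>) \<le> 1 - \<alpha>" by (simp add: algebra_simps)
qed

lemma theta_beta: "\<theta> * \<beta> \<le> 1 / 2"
proof -
  have "\<theta> * (\<beta> / 2) \<le> \<theta> * S" using S_ge(2) \<theta> by (intro mult_left_mono) auto
  then show ?thesis using theta_S_le \<alpha> by simp
qed

text \<open>All rests on b \<le> \<beta>^2 and \<theta>\<beta> \<le> 1/2, which give \<theta> b
  \<le> \<beta>/2.\<close>

lemma w_bounds: "w \<le> \<beta> * \<rho> / 4" "w * \<theta> \<le> \<rho> / 8" "w \<le> \<beta> / 4" "4 * w \<le> 1"
proof -
  have "\<theta> * b \<le> \<theta> * \<beta>\<^sup>2" using beta_bounds(2) \<theta> by simp
  then have 1: "\<theta> * b \<le> (\<theta> * \<beta>) * \<beta>" by (simp add: power2_eq_square)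
  also have "\<dots> \<le> 1 / 2 * \<beta>" using theta_beta beta_bounds(3) by (intro mult_right_mono) auto
  finally have "(\<theta> * b) * (\<rho> / 2) \<le> (1 / 2 * \<beta>) * (\<rho> / 2)"
    using rho_bounds by (intro mult_right_mono) auto
  then show 2: "w \<le> \<beta> * \<rho> / 4" unfolding \<theta>(2) by argo
  have "\<beta> * \<rho> \<le> \<beta> * 1" using rho_bounds beta_bounds by (intro mult_left_mono) auto
  with 2 show 3: "w \<le> \<beta> / 4" by simp
  then show "4 * w \<le> 1" using beta_bounds(4) by simp
  have "w * \<theta> \<le> \<beta> * \<rho> / 4 * \<theta>" using 2 \<theta>(1) by (intro mult_right_mono) auto
  also have "\<dots> = \<rho> / 4 * (\<theta> * \<beta>)" by simp
  also have "\<dots> \<le> \<rho> / 4 * (1 / 2)" using theta_beta rho_bounds by (intro mult_left_mono) auto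
  finally show "w * \<theta> \<le> \<rho> / 8" by simp
qed

lemma mw_le: "m * w \<le> w" using m w_pos by simp

text \<open>Every term of S is at most a multiple of \<beta>, because \<alpha> \<le> \<beta>/3 and w
  \<le> \<beta>/4. Hence \<open>root\<close> bounds \<theta>\<rho>\<beta> from below, and w =
  \<theta> b \<rho>/2 is at least a multiple of b/\<beta>, which is b to the power 1 - \<gamma>. The
  estimates give about 1/94, so 1/150 leaves room.\<close>

lemma rate_le: "1 / 150 * (b / \<beta>) \<le> w"
proof -
  have "\<beta> * \<alpha>\<^sup>2 \<le> \<beta> * (1 / 9)" using beta_bounds alpha_sq \<alpha> by (intro mult_left_mono) auto
  moreover have "\<alpha>\<^sup>2 \<le> \<beta> / 9" using alpha_sq beta_bounds(1) by simp
  ultimately have "S \<le> 26 / 10 * \<beta>"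
    using w_bounds(3) mw_le beta_bounds(1,3) S_eq by linarith
  then have "(4 * \<theta> * (\<rho> * (1 + \<alpha>))) * S \<le> (4 * \<theta> * (\<rho> * (1 + \<alpha>))) * (26 / 10 * \<beta>)"
    using rho_bounds \<alpha> \<theta> by (intro mult_left_mono) auto
  then have "(1 - \<alpha>) ^ 3 \<le> 104 / 10 * (\<theta> * \<rho> * \<beta>) * (1 + \<alpha>)"
    unfolding root[symmetric] by (simp add: mult_ac)
  also have "\<dots> \<le> 104 / 10 * (\<theta> * \<rho> * \<beta>) * (4 / 3)"
    using \<theta> rho_bounds beta_bounds \<alpha> by (intro mult_left_mono) auto
  finally have "(1 - \<alpha>) ^ 3 \<le> 416 / 30 * (\<theta> * \<rho> * \<beta>)" by simp
  moreover have "(2 / 3) ^ 3 \<le> (1 - \<alpha>) ^ 3" using \<alpha> by (intro power_mono) auto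
  ultimately have "1 \<le> 75 * (\<theta> * \<rho> * \<beta>)" by (simp add: power3_eq_cube)
  then have "b * 1 \<le> b * (75 * (\<theta> * \<rho> * \<beta>))" using b by (intro mult_left_mono) auto
  also have "\<dots> = 150 * w * \<beta>" by (simp add: \<theta>(2))
  finally have "b \<le> 150 * w * \<beta>" by simp
  then show ?thesis using beta_bounds(3) by (simp add: field_simps)
qed

lemma small_noise_params:
  assumes "\<alpha> \<le> 11 / 50"
  shows "12 / 100 \<le> \<theta>" "\<rho> / 8 + w * \<theta> \<le> (1 - 2 * \<alpha>) / 4" "64 / 10 \<le> 5 + 1 / \<beta>"
proof -
  have a2: "\<alpha>\<^sup>2 \<le> 11 / 50 * \<alpha>"
    using mult_right_mono[OF assms \<alpha>(1)] by (simp add: power2_eq_square)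
  \<comment> \<open>This product is (1 - 2\<alpha>)(1 + \<alpha>)^2 - (1 - \<alpha>).\<close>
  have "0 \<le> \<alpha> * (1 - 3 * \<alpha> - 2 * \<alpha>\<^sup>2)" using a2 assms \<alpha> by (intro mult_nonneg_nonneg) auto
  then have "1 - \<alpha> \<le> (1 - 2 * \<alpha>) * (1 + \<alpha>)\<^sup>2"
    by (simp add: power2_eq_square algebra_simps)
  with \<rho>(2) have "\<rho> * (1 + \<alpha>)\<^sup>2 \<le> (1 - 2 * \<alpha>) * (1 + \<alpha>)\<^sup>2" by linarith
  then have \<rho>': "\<rho> \<le> 1 - 2 * \<alpha>" using \<alpha> by simp
  then show "\<rho> / 8 + w * \<theta> \<le> (1 - 2 * \<alpha>) / 4" using w_bounds(2) by simp
  note \<beta>7 = beta_bounds(5)[OF assms]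
  have "1 / (7072 / 10000) \<le> 1 / \<beta>" using \<beta>7 beta_bounds(3) by (intro divide_left_mono) auto
  then show "64 / 10 \<le> 5 + 1 / \<beta>" by simp
  have "\<beta> * \<rho> \<le> 7072 / 10000 * (1 - 2 * \<alpha>)"
    using \<beta>7 \<rho>' rho_bounds beta_bounds by (intro mult_mono) auto
  then have w: "m * w \<le> 1768 / 10000 * (1 - 2 * \<alpha>)" using w_bounds(1) mw_le by simp
  have "\<beta> / 2 * (1 + \<alpha>\<^sup>2) \<le> 3536 / 10000 * (1 + \<alpha>\<^sup>2)"
    using \<beta>7 by (intro mult_right_mono) auto
  \<comment> \<open>The resulting upper bound for S increases with \<alpha>; its value at 11/50 is
    rounded up.\<close>
  then have S': "S \<le> 15435 / 10000"
    unfolding S using w a2 assms by simp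
  have "(1 - (11 / 50)\<^sup>2) * (39 / 50) \<le> (1 - \<alpha>\<^sup>2) * (1 - \<alpha>)"
    using a2 assms \<alpha> by (intro mult_mono) (auto simp: power2_eq_square)
  also have "\<dots> = (1 - \<alpha>)\<^sup>2 * (1 + \<alpha>)" by (simp add: power2_eq_square algebra_simps)
  also have "\<dots> \<le> 4 * (\<theta> * S)" by (rule theta_S_ge)
  also have "\<dots> \<le> 4 * (\<theta> * (15435 / 10000))" using S' \<theta> by simp
  finally show "12 / 100 \<le> \<theta>" by (simp add: power2_eq_square)
qed

lemma large_noise_params:
  assumes "11 / 50 \<le> \<alpha>"
  shows "62 / 1000 \<le> \<theta>" "\<theta> \<le> 14 / 100" "\<alpha> * \<theta> \<le> 31 / 1000"
    "\<alpha> + 16 / 10 * \<theta> \<le> 452 / 1000" "\<rho> / 8 + w * \<theta> \<le> 7 / 100"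
proof -
  have a2: "11 / 50 * \<alpha> \<le> \<alpha>\<^sup>2"
    using mult_right_mono[OF assms \<alpha>(1)] by (simp add: power2_eq_square)
  define K where "K = 22 * \<alpha> + 16 * \<alpha>\<^sup>2"
  have \<theta>K: "\<theta> * K \<le> 1 - \<alpha>" using theta_alpha(1) by (simp add: K_def algebra_simps)
  have K: "0 < K" using assms a2 by (simp add: K_def)
  have "\<theta> * (2552 / 100 * \<alpha>) \<le> \<theta> * K"
    using a2 \<theta> unfolding K_def by (intro mult_left_mono) auto
  then have "2552 / 100 * (\<alpha> * \<theta>) \<le> 1 - \<alpha>" using \<theta>K by (simp add: mult_ac)
  then show \<alpha>\<theta>: "\<alpha> * \<theta> \<le> 31 / 1000" using assms by linarith
  have "\<theta> * (56144 / 10000) \<le> \<theta> * K"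
    using \<theta> a2 assms unfolding K_def by (intro mult_left_mono) auto
  then show \<theta>': "\<theta> \<le> 14 / 100" using \<theta>K assms by linarith
  \<comment> \<open>The joint bound amounts to a cubic inequality in \<alpha>, concave on
    [11/50, 1/3]. Replacing \<alpha>^2 by its chord, and \<alpha>^3 by \<alpha> times that chord,
    makes it linear.\<close>
  have "0 \<le> (\<alpha> - 11 / 50) * (1 / 3 - \<alpha>)" using assms \<alpha> by simp
  also have "\<dots> = 83 / 150 * \<alpha> - 11 / 150 - \<alpha>\<^sup>2"
    by (simp add: power2_eq_square field_simps)
  finally have p2: "0 \<le> 83 / 150 * \<alpha> - 11 / 150 - \<alpha>\<^sup>2" .
  then have "0 \<le> (83 / 150 * \<alpha> - 11 / 150 - \<alpha>\<^sup>2) * \<alpha>" using \<alpha> by simp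
  also have "\<dots> = 83 / 150 * \<alpha>\<^sup>2 - 11 / 150 * \<alpha> - \<alpha> ^ 3"
    by (simp add: power2_eq_square power3_eq_cube field_simps)
  finally have p3: "0 \<le> 83 / 150 * \<alpha>\<^sup>2 - 11 / 150 * \<alpha> - \<alpha> ^ 3" .
  have "(452 / 1000 - \<alpha>) * K = 9944 / 1000 * \<alpha> - 14768 / 1000 * \<alpha>\<^sup>2 - 16 * \<alpha> ^ 3"
    by (simp add: K_def power2_eq_square power3_eq_cube field_simps)
  then have "16 / 10 * (1 - \<alpha>) \<le> (452 / 1000 - \<alpha>) * K"
    using p2 p3 \<alpha>(2) by argo
  with \<theta>K have "(16 / 10 * \<theta>) * K \<le> (452 / 1000 - \<alpha>) * K" by simp
  then show "\<alpha> + 16 / 10 * \<theta> \<le> 452 / 1000" using K by simp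
  have "(1 + 11 / 50)\<^sup>2 \<le> (1 + \<alpha>)\<^sup>2" using assms by (intro power_mono) auto
  then have "\<rho> * (1 + 11 / 50)\<^sup>2 \<le> \<rho> * (1 + \<alpha>)\<^sup>2" using rho_bounds by (intro mult_left_mono) auto
  then have \<rho>': "\<rho> \<le> 525 / 1000" using \<rho>(2) assms by (simp add: power2_eq_square)
  have "\<theta> * b \<le> 14 / 100 * (1 / 2)" using \<theta>' \<theta> b by (intro mult_mono) auto
  then have "(\<theta> * b) * \<rho> \<le> (14 / 100 * (1 / 2)) * (525 / 1000)"
    using \<rho>' rho_bounds \<theta> b by (intro mult_mono[where a = "\<theta> * b"]) auto
  then have w: "w \<le> 184 / 10000" unfolding \<theta>(2) by argo
  have "w * \<theta> \<le> 184 / 10000 * (14 / 100)" using w \<theta>' w_pos \<theta>(1) by (intro mult_mono) auto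
  then show "\<rho> / 8 + w * \<theta> \<le> 7 / 100" using \<rho>' by simp
  have "\<beta> / 2 * (1 + \<alpha>\<^sup>2) \<le> 1 / 2 * (1 + \<alpha>\<^sup>2)"
    using beta_bounds by (intro mult_right_mono) auto
  then have S': "S \<le> 2352 / 1000" unfolding S using w mw_le \<alpha> alpha_sq by simp
  have "(1 - (1 / 3)\<^sup>2) * (2 / 3) \<le> (1 - \<alpha>\<^sup>2) * (1 - \<alpha>)"
    using alpha_sq \<alpha> by (intro mult_mono) (auto simp: power2_eq_square)
  also have "\<dots> = (1 - \<alpha>)\<^sup>2 * (1 + \<alpha>)" by (simp add: power2_eq_square algebra_simps)
  also have "\<dots> \<le> 4 * (\<theta> * S)" by (rule theta_S_ge)
  also have "\<dots> \<le> 4 * (\<theta> * (2352 / 1000))" using S' \<theta> by simp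
  finally show "62 / 1000 \<le> \<theta>" by (simp add: power2_eq_square)
qed

end

subsection \<open>Convergence\<close>

lemma linear_recurrence_le:
  fixes V :: "nat \<Rightarrow> real"
  assumes "w \<le> 1" and "\<And>k. V (Suc k) \<le> (1 - w) * V k + w * c" and "0 \<le> c"
  shows "V k \<le> (1 - w) ^ k * V 0 + c"
proof (induction k)
  case (Suc k)
  have "(1 - w) * V k \<le> (1 - w) * ((1 - w) ^ k * V 0 + c)"
    using assms(1) Suc by (intro mult_left_mono) auto
  with assms(2)[of k] show ?case by (simp add: algebra_simps)
qed (use assms in simp)

text \<open>With E = (1 - w)^k V0, one step turns the bound E + F into at most (1 - 3w) E + (1 - 4w)
  F + w (c + d). The constant part does not exceed F because c + d \<le> 4F, and 1 - 3w \<le> 1 - w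
  keeps the rate of V.\<close>

lemma coupled_recurrence_le:
  fixes A V :: "nat \<Rightarrow> real"
  assumes w: "0 \<le> w" "4 * w \<le> 1"
    and A: "\<And>k. A (Suc k) \<le> (1 - 4 * w) * A k + w * V k + w * d" and A0: "A 0 \<le> V0"
    and V: "\<And>k. V k \<le> (1 - w) ^ k * V0 + c" and V0: "0 \<le> V0" and F: "0 \<le> F" "c + d \<le> 4 * F"
  shows "A k \<le> (1 - w) ^ k * V0 + F"
proof (induction k)
  case 0
  then show ?case using A0 F by simp
next
  case (Suc k)
  define E where "E = (1 - w) ^ k * V0"
  have E: "0 \<le> E" using w V0 by (simp add: E_def)
  have "(1 - 4 * w) * A k \<le> (1 - 4 * w) * (E + F)"
    using w Suc unfolding E_def by (intro mult_left_mono) auto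
  moreover have "w * V k \<le> w * (E + c)"
    using w V unfolding E_def by (intro mult_left_mono) auto
  moreover have "w * (c + d) \<le> w * (4 * F)" using w F by (intro mult_left_mono) auto
  moreover have "0 \<le> w * E" using w E by simp
  ultimately have "A (Suc k) \<le> (1 - w) * E + F"
    using A[of k] unfolding distrib_left left_diff_distrib by argo
  then show ?case by (simp add: E_def)
qed

section \<open>The estimates for the actual coefficients, and the iteration\<close>

context
  fixes L \<mu> \<alpha> :: real
  assumes L: "0 < \<mu>" "\<mu> \<le> L" and \<alpha>: "0 \<le> \<alpha>" "\<alpha> \<le> 1 / 3"
begin

private abbreviation (input) "b \<equiv> \<mu> / (2 * L)"
private abbreviation (input) "\<beta> \<equiv> b powr gamma_star L \<mu> \<alpha>"
private abbreviation (input) "\<rho> \<equiv> ((1 - \<alpha>) / (1 + \<alpha>)) powr (3 / 2)"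
private abbreviation (input) "\<theta> \<equiv> omega L \<mu> \<alpha> / (\<mu> * step_size L \<alpha>)"

lemma RE_AGM_base: "0 < b" "b \<le> 1 / 2" "0 < \<rho>" "0 < \<beta>" "\<beta> \<le> 1"
  "L * step_size L \<alpha> = \<rho> / 4" "0 < step_size L \<alpha>"
proof -
  show b: "0 < b" "b \<le> 1 / 2" using L by (auto simp: field_simps)
  show "0 < \<beta>" using L by simp
  have "sqrt b \<le> 1" using b by simp
  then show "\<beta> \<le> 1" using powr_gamma_star[of \<mu> L \<alpha>] L \<alpha> by simp
  show "0 < \<rho>" using \<alpha> by simp
  then show "0 < step_size L \<alpha>" using L by (simp add: step_size_def)
  show "L * step_size L \<alpha> = \<rho> / 4" using L by (simp add: step_size_def)
qed

lemma m_coeff_bounds: "0 < m_coeff L \<mu> \<alpha>" "m_coeff L \<mu> \<alpha> \<le> 1"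
proof -
  have a2: "\<alpha>\<^sup>2 \<le> 1 / 9" using power_mono[OF \<alpha>(2,1), of 2] by (simp add: power2_eq_square)
  have "(2 / 3)\<^sup>2 \<le> (1 - \<alpha>)\<^sup>2" using \<alpha> by (intro power_mono) auto
  then have "3 / 4 * (4 / 9) \<le> (1 - 1 / 4 * \<beta>) * (1 - \<alpha>)\<^sup>2"
    using RE_AGM_base(4,5) by (intro mult_mono) (auto simp: power2_eq_square)
  then show "0 < m_coeff L \<mu> \<alpha>" unfolding m_coeff_def using a2 by argo
  have "(1 - 1 / 4 * \<beta>) * (1 - \<alpha>)\<^sup>2 \<le> 1 * 1"
    using RE_AGM_base(4,5) \<alpha> by (intro mult_mono power_le_one) auto
  then show "m_coeff L \<mu> \<alpha> \<le> 1" unfolding m_coeff_def using zero_le_power2[of \<alpha>] by argo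
qed

lemma omega_root:
  "0 < omega L \<mu> \<alpha>"
  "m_coeff L \<mu> \<alpha> * (omega L \<mu> \<alpha>)\<^sup>2 + (s_coeff L \<mu> \<alpha> - m_coeff L \<mu> \<alpha>) * omega L \<mu> \<alpha> = q_coeff L \<mu> \<alpha>"
proof -
  have "0 < q_coeff L \<mu> \<alpha>" using L \<alpha> by (simp add: q_coeff_def L_hat_def)
  from quadratic_root[OF m_coeff_bounds(1) this refl, of "s_coeff L \<mu> \<alpha>"]
  show "0 < omega L \<mu> \<alpha>"
    "m_coeff L \<mu> \<alpha> * (omega L \<mu> \<alpha>)\<^sup>2 + (s_coeff L \<mu> \<alpha> - m_coeff L \<mu> \<alpha>) * omega L \<mu> \<alpha> = q_coeff L \<mu> \<alpha>"
    by (simp_all add: omega_def Let_def)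
qed

lemma omega_eq: "omega L \<mu> \<alpha> = \<theta> * b * \<rho> / 2" "0 < \<theta>"
proof -
  have "\<mu> * step_size L \<alpha> = b * \<rho> / 2" using L by (simp add: step_size_def)
  moreover have "0 < b * \<rho> / 2" using half_gt_zero[OF mult_pos_pos[OF RE_AGM_base(1,3)]] .
  ultimately show "omega L \<mu> \<alpha> = \<theta> * b * \<rho> / 2" by (metis (no_types, lifting) less_numeral_extra(3) mult.assoc nonzero_eq_divide_eq times_divide_eq_right)
  show "0 < \<theta>" using omega_root(1) RE_AGM_base(7) L by simp
qed

text \<open>This is w S = q with w = \<theta> b \<rho>/2 and q = b (1 - \<alpha>)^3/(8 (1 +
  \<alpha>)), divided by b.\<close>

lemma theta_root:
  "4 * (\<theta> * (m_coeff L \<mu> \<alpha> * omega L \<mu> \<alpha> + 4 * \<alpha> + 4 * \<alpha>\<^sup>2 + \<beta> / 2 * (1 + \<alpha>\<^sup>2))) * (\<rho> * (1 + \<alpha>))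
    = (1 - \<alpha>) ^ 3"
proof -
  define w where "w = omega L \<mu> \<alpha>"
  define t where "t = \<theta>"
  define S where "S = m_coeff L \<mu> \<alpha> * w + 4 * \<alpha> + 4 * \<alpha>\<^sup>2 + \<beta> / 2 * (1 + \<alpha>\<^sup>2)"
  have "s_coeff L \<mu> \<alpha> - m_coeff L \<mu> \<alpha> = 4 * \<alpha> + 4 * \<alpha>\<^sup>2 + \<beta> / 2 * (1 + \<alpha>\<^sup>2)"
    by (simp add: s_coeff_def m_coeff_def power2_eq_square field_simps)
  then have S_eq: "S = m_coeff L \<mu> \<alpha> * w + (s_coeff L \<mu> \<alpha> - m_coeff L \<mu> \<alpha>)" by (simp add: S_def)
  have "w * S = m_coeff L \<mu> \<alpha> * w\<^sup>2 + (s_coeff L \<mu> \<alpha> - m_coeff L \<mu> \<alpha>) * w"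
    unfolding S_eq by (simp add: power2_eq_square algebra_simps)
  also have "\<dots> = q_coeff L \<mu> \<alpha>" unfolding w_def by (rule omega_root(2))
  also have "\<dots> = b * (1 - \<alpha>) ^ 3 / (8 * (1 + \<alpha>))"
    using L \<alpha> by (simp add: q_coeff_def L_hat_def)
  finally have "w * S = b * (1 - \<alpha>) ^ 3 / (8 * (1 + \<alpha>))" .
  moreover have "8 * (1 + \<alpha>) \<noteq> 0" using \<alpha> by simp
  ultimately have "w * S * (8 * (1 + \<alpha>)) = b * (1 - \<alpha>) ^ 3" by (metis nonzero_eq_divide_eq)
  moreover have "w = t * b * \<rho> / 2" using omega_eq(1) unfolding w_def t_def .
  moreover have "t * c * \<rho> / 2 * S * (8 * (1 + \<alpha>)) = c * (4 * (t * S) * (\<rho> * (1 + \<alpha>)))" for c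
    by (simp add: algebra_simps)
  ultimately have "b * (4 * (t * S) * (\<rho> * (1 + \<alpha>))) = b * (1 - \<alpha>) ^ 3"
    by metis
  moreover have "b \<noteq> 0" using L by simp
  ultimately have "4 * (t * S) * (\<rho> * (1 + \<alpha>)) = (1 - \<alpha>) ^ 3" by (metis mult_left_cancel)
  then show ?thesis unfolding t_def S_def w_def .
qed

lemma step_params:
  "4 * omega L \<mu> \<alpha> \<le> 1"
  "omega L \<mu> \<alpha> * \<theta> \<le> \<rho> / 8"
  "\<rho> \<le> 1"
  "1 / 150 * (b / \<beta>) \<le> omega L \<mu> \<alpha>"
  "22 * (\<alpha> * \<theta>) \<le> 1 - \<alpha>"
  "\<alpha> \<le> 11 / 50 \<Longrightarrow> 12 / 100 \<le> \<theta>"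
  "\<alpha> \<le> 11 / 50 \<Longrightarrow> \<rho> / 8 + omega L \<mu> \<alpha> * \<theta> \<le> (1 - 2 * \<alpha>) / 4"
  "\<alpha> \<le> 11 / 50 \<Longrightarrow> 64 / 10 \<le> 5 + 1 / \<beta>"
  "11 / 50 \<le> \<alpha> \<Longrightarrow> 62 / 1000 \<le> \<theta>"
  "11 / 50 \<le> \<alpha> \<Longrightarrow> \<theta> \<le> 14 / 100"
  "11 / 50 \<le> \<alpha> \<Longrightarrow> \<alpha> * \<theta> \<le> 31 / 1000"
  "11 / 50 \<le> \<alpha> \<Longrightarrow> \<alpha> + 16 / 10 * \<theta> \<le> 452 / 1000"
  "11 / 50 \<le> \<alpha> \<Longrightarrow> \<rho> / 8 + omega L \<mu> \<alpha> * \<theta> \<le> 7 / 100"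
proof -
  have \<alpha>1: "\<alpha> < 1" using \<alpha> by simp
  \<comment> \<open>The facts follow the order of the assumptions of the abstract context;
    \<open>refl\<close> instantiates S by its defining expression.\<close>
  note hyps = \<alpha> RE_AGM_base(1,2) powr_gamma_star[OF L \<alpha>(1)]
    powr_three_halves_bounds[OF \<alpha>(1) \<alpha>1] omega_eq(2,1) less_imp_le[OF m_coeff_bounds(1)]
    m_coeff_bounds(2) refl theta_root
  show "4 * omega L \<mu> \<alpha> \<le> 1" by (rule w_bounds(4)[OF hyps])
  show "omega L \<mu> \<alpha> * \<theta> \<le> \<rho> / 8" by (rule w_bounds(2)[OF hyps])
  show "\<rho> \<le> 1" by (rule rho_bounds(2)[OF hyps])
  show "1 / 150 * (b / \<beta>) \<le> omega L \<mu> \<alpha>" by (rule rate_le[OF hyps])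
  show "22 * (\<alpha> * \<theta>) \<le> 1 - \<alpha>" by (rule theta_alpha(2)[OF hyps])
  show "12 / 100 \<le> \<theta>" "\<rho> / 8 + omega L \<mu> \<alpha> * \<theta> \<le> (1 - 2 * \<alpha>) / 4" "64 / 10 \<le> 5 + 1 / \<beta>"
    if "\<alpha> \<le> 11 / 50" using small_noise_params[OF hyps that] by this+
  show "62 / 1000 \<le> \<theta>" "\<theta> \<le> 14 / 100" "\<alpha> * \<theta> \<le> 31 / 1000" "\<alpha> + 16 / 10 * \<theta> \<le> 452 / 1000"
    "\<rho> / 8 + omega L \<mu> \<alpha> * \<theta> \<le> 7 / 100"
    if "11 / 50 \<le> \<alpha>" using large_noise_params[OF hyps that] by this+
qed

lemma RE_AGM_gap_le:
  fixes f :: "real ^ 'n \<Rightarrow> real" and f' g :: "real ^ 'n \<Rightarrow> real ^ 'n" and x0 xs :: "real ^ 'n"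
  assumes smooth: "smooth_with L f f'" and sc: "strongly_convex_with \<mu> f f'"
    and min: "\<forall>x. f xs \<le> f x" and noise: "composite_noise \<alpha> \<delta> f' g"
  shows "f (RE_AGM_x g L \<mu> x0 \<alpha> N) - f xs
    \<le> (1 - omega L \<mu> \<alpha>) ^ N * (f x0 - f xs + \<mu> / 4 * (norm (x0 - xs))\<^sup>2)
      + (1 / \<beta> + 5) * (\<delta>\<^sup>2 / \<mu>)"
proof -
  define w where "w = omega L \<mu> \<alpha>"
  define h where "h = step_size L \<alpha>"
  define t where "t = \<theta>"
  define D where "D = \<delta>\<^sup>2 / \<mu>"
  define x where "x k = fst (RE_AGM g L \<mu> x0 \<alpha> k)" for k
  define u where "u k = snd (RE_AGM g L \<mu> x0 \<alpha> k)" for k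
  define y where "y k = (1 / (1 + w)) *\<^sub>R (w *\<^sub>R u k + x k)" for k
  define n where "n k = norm (f' (y k))" for k
  define A where "A k = f (x k) - f xs" for k
  define V where "V k = A k + \<mu> / 4 * (norm (u k - xs))\<^sup>2" for k
  have xS: "x (Suc k) = y k - h *\<^sub>R g (y k)" for k
    by (simp add: x_def u_def y_def h_def w_def Let_def case_prod_beta)
  have uS: "u (Suc k) = (1 - w) *\<^sub>R u k + w *\<^sub>R y k - (2 * w / \<mu>) *\<^sub>R g (y k)" for k
    by (simp add: x_def u_def y_def h_def w_def Let_def case_prod_beta)
  have w: "0 < w" "4 * w \<le> 1" using omega_root(1) step_params(1) by (simp_all add: w_def)
  have h: "0 < h" "L * h = \<rho> / 4" using RE_AGM_base by (simp_all add: h_def)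
  have wt: "w = t * \<mu> * h" using L h by (simp add: t_def w_def h_def)
  have t: "0 < t" using omega_eq(2) by (simp add: t_def)
  \<comment> \<open>Since h \<theta> = w/\<mu>, the noise of one step carries the factor w, so the
    accumulated noise does not depend on w.\<close>
  have wtD: "h * (t * c * \<delta>\<^sup>2) = w * (c * D)" for c using L wt by (simp add: D_def)
  have D: "0 \<le> D" using L by (simp add: D_def)
  have c: "L * h / 2 = \<rho> / 8" "L * h / 2 + w * t \<le> 1 / 2" "L * h / 2 \<le> L * h / 2 + w * t"
  proof -
    have "w * t \<le> \<rho> / 8" using step_params(2) unfolding w_def t_def .
    moreover have "0 \<le> w * t" using w t by simp
    ultimately show "L * h / 2 = \<rho> / 8" "L * h / 2 + w * t \<le> 1 / 2" "L * h / 2 \<le> L * h / 2 + w * t"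
      using h(2) step_params(3) by linarith+
  qed
  have descent: "f (x (Suc k)) \<le> f (y k) - h * (f' (y k) \<bullet> g (y k)) + L / 2 * (h\<^sup>2 * (g (y k) \<bullet> g (y k)))" for k
    using smooth[unfolded smooth_with_def, rule_format, of "x (Suc k)" "y k"] unfolding xS
    by (simp add: power_mult_distrib power2_norm_eq_inner)
  have scD: "f v + f' v \<bullet> (z - v) + \<mu> / 2 * (norm (z - v))\<^sup>2 \<le> f z" for v z
    using sc unfolding strongly_convex_with_def by (simp add: norm_minus_commute)
  \<comment> \<open>A gradient step of length 1/L from the minimizer would otherwise decrease f, by
    smoothness.\<close>
  have "f' xs = 0"
  proof -
    have "f xs \<le> f (xs - (1 / L) *\<^sub>R f' xs)" using min by simp
    also have "\<dots> \<le> f xs + f' xs \<bullet> (- ((1 / L) *\<^sub>R f' xs)) + L / 2 * (norm ((1 / L) *\<^sub>R f' xs))\<^sup>2"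
      using smooth[unfolded smooth_with_def, rule_format, of "xs - (1 / L) *\<^sub>R f' xs" xs] by simp
    also have "\<dots> = f xs - 1 / (2 * L) * (f' xs \<bullet> f' xs)"
      unfolding norm_scaleR power_mult_distrib power2_norm_eq_inner
      using L by (simp add: power2_eq_square field_simps)
    finally have "f' xs \<bullet> f' xs \<le> 0" using L by (simp add: field_simps)
    then show ?thesis using inner_ge_zero[of "f' xs"] inner_eq_zero_iff[of "f' xs"] by linarith
  qed
  then have grow: "f xs + \<mu> / 2 * (norm (z - xs))\<^sup>2 \<le> f z" for z using scD[of xs z] by simp
  have e: "norm (g (y k) - f' (y k)) \<le> \<alpha> * n k + \<delta>" for k
    using noise unfolding composite_noise_def n_def by simp
  have w1: "w \<le> 1" and L0: "0 < L" and c1: "L * h / 2 \<le> 1 / 2" using w L c(2,3) by linarith+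
  note step = L(1) h(1) less_imp_le[OF w(1)] w1 L0 y_def wt e[unfolded n_def] descent scD scD
  have V_step: "V (Suc k) \<le> (1 - w) * V k + h * (- (n k)\<^sup>2 + n k * (\<alpha> * n k + \<delta>)
      + (L * h / 2 + w * t) * (n k - (\<alpha> * n k + \<delta>))\<^sup>2 + 2 * t * (\<alpha> * n k + \<delta>)\<^sup>2)" for k
    unfolding V_def A_def uS n_def by (rule potential_step[OF step c(2)])
  have A_step: "A (Suc k) \<le> (1 - 4 * w) * A k + w * V k + h * (- (n k)\<^sup>2 + n k * (\<alpha> * n k + \<delta>)
      + (L * h / 2) * (n k - (\<alpha> * n k + \<delta>))\<^sup>2 + 4 * t * (n k)\<^sup>2)" for k
    unfolding V_def A_def n_def by (rule gap_step[OF step c1 w(2) grow min[rule_format]])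
  have A0: "0 \<le> A k" for k using min by (simp add: A_def)
  have VA: "A k \<le> V k" for k using L by (simp add: V_def)
  have "1 \<le> 1 / \<beta>" using RE_AGM_base(4,5) by simp
  then have \<beta>: "6 * D \<le> (1 / \<beta> + 5) * D" "0 \<le> 1 / \<beta> + 5" using D by (intro mult_right_mono) auto
  have "A N \<le> (1 - w) ^ N * V 0 + (1 / \<beta> + 5) * D"
  proof (cases "\<alpha> \<le> 11 / 50")
    case True
    have "V (Suc k) \<le> (1 - w) * V k + w * ((5 + 1 / \<beta>) * D)" for k
    proof -
      have "h * (- (n k)\<^sup>2 + n k * (\<alpha> * n k + \<delta>)
          + (L * h / 2 + w * t) * (n k - (\<alpha> * n k + \<delta>))\<^sup>2 + 2 * t * (\<alpha> * n k + \<delta>)\<^sup>2)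
        \<le> h * (t * (5 + 1 / \<beta>) * \<delta>\<^sup>2)"
        using True \<alpha>(1) step_params(5) step_params(6-8)[OF True] h(1) unfolding c(1) t_def w_def
        by (intro mult_left_mono small_noise_form_le) simp_all
      then show ?thesis using V_step[of k] unfolding wtD by linarith
    qed
    then have "V N \<le> (1 - w) ^ N * V 0 + (5 + 1 / \<beta>) * D"
      using w \<beta> D by (intro linear_recurrence_le) auto
    then show ?thesis using VA[of N] by (simp add: add.commute)
  next
    case False
    then have \<alpha>': "11 / 50 \<le> \<alpha>" by simp
    note th = step_params(9-12)[OF \<alpha>', folded t_def]
    have c': "L * h / 2 + w * t \<le> 7 / 100"
      using step_params(13)[OF \<alpha>'] unfolding c(1) t_def w_def .
    have "V (Suc k) \<le> (1 - w) * V k + w * (11 * D)" for k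
    proof -
      have "h * (- (n k)\<^sup>2 + n k * (\<alpha> * n k + \<delta>)
          + (L * h / 2 + w * t) * (n k - (\<alpha> * n k + \<delta>))\<^sup>2 + 2 * t * (\<alpha> * n k + \<delta>)\<^sup>2)
        \<le> h * (t * 11 * \<delta>\<^sup>2)"
        using \<alpha> c' th h(1) by (intro mult_left_mono large_noise_form_le) simp_all
      then show ?thesis using V_step[of k] unfolding wtD by linarith
    qed
    then have "V k \<le> (1 - w) ^ k * V 0 + 11 * D" for k
      using w D by (intro linear_recurrence_le) auto
    moreover have "A (Suc k) \<le> (1 - 4 * w) * A k + w * V k + w * (13 * D)" for k
    proof -
      have "h * (- (n k)\<^sup>2 + n k * (\<alpha> * n k + \<delta>)
          + (L * h / 2) * (n k - (\<alpha> * n k + \<delta>))\<^sup>2 + 4 * t * (n k)\<^sup>2)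
        \<le> h * (t * 13 * \<delta>\<^sup>2)"
        using \<alpha> c' c(3) th h(1) by (intro mult_left_mono large_noise_gap_form_le) simp_all
      then show ?thesis using A_step[of k] unfolding wtD by linarith
    qed
    ultimately have "A N \<le> (1 - w) ^ N * V 0 + 6 * D"
      using w D VA A0[of 0] order_trans[OF A0 VA] by (intro coupled_recurrence_le[where c = "11 * D" and d = "13 * D"]) auto
    then show ?thesis using \<beta> by simp
  qed
  then show ?thesis
    unfolding A_def V_def D_def w_def by (simp add: RE_AGM_x_def x_def u_def)
qed

end

text \<open>Keeps both \<gamma> and 1 - \<gamma> below 1, as the passage from \<mu>/(2L) to \<mu>/L
  requires.\<close>

lemma gamma_star_bounds:
  assumes "0 < \<mu>" "\<mu> \<le> L" "0 \<le> \<alpha>" "\<alpha> \<le> 1 / 3"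
  shows "0 \<le> gamma_star L \<mu> \<alpha>" "gamma_star L \<mu> \<alpha> \<le> 1 / 2"
proof -
  have "0 \<le> log (\<mu> / (2 * L)) (3 * \<alpha>)" if "\<alpha> \<noteq> 0"
    using assms that unfolding log_def by (intro divide_nonpos_nonpos) auto
  then show "0 \<le> gamma_star L \<mu> \<alpha>" by (simp add: gamma_star_def)
  show "gamma_star L \<mu> \<alpha> \<le> 1 / 2" unfolding gamma_star_def by (metis min.cobounded2 order_refl)
qed

theorem theorem6p1:
  fixes f :: "real ^ 'n \<Rightarrow> real"
    and f' g :: "real ^ 'n \<Rightarrow> real ^ 'n"
    and x0 xstar :: "real ^ 'n"
    and L \<mu> \<alpha> \<delta> R \<gamma> :: real
    and N :: nat
  assumes "0 < \<mu>" and "\<mu> \<le> L"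
    and "is_gradient f f'"
    and "smooth_with L f f'"
    and "strongly_convex_with \<mu> f f'"
    and "\<forall>x. f xstar \<le> f x"
    and "0 \<le> \<alpha>" and "\<alpha> \<le> 1 / 3" and "0 \<le> \<delta>"
    and "composite_noise \<alpha> \<delta> f' g"
    and "R = norm (x0 - xstar)"
    and "\<gamma> = gamma_star L \<mu> \<alpha>"
  shows "f (RE_AGM_x g L \<mu> x0 \<alpha> N) - f xstar
           \<le> (1 - 1 / 150 * (\<mu> / (2 * L)) powr (1 - \<gamma>)) ^ N
                * (f x0 - f xstar + \<mu> / 4 * R\<^sup>2)
             + ((2 * L / \<mu>) powr \<gamma> + 5) * (\<delta>\<^sup>2 / \<mu>)
       \<and> f (RE_AGM_x g L \<mu> x0 \<alpha> N) - f xstar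
           \<le> (1 - 1 / 300 * (\<mu> / L) powr (1 - \<gamma>)) ^ N
                * (f x0 - f xstar + \<mu> / 4 * R\<^sup>2)
             + (2 * (L / \<mu>) powr \<gamma> + 5) * (\<delta>\<^sup>2 / \<mu>)"
proof -
  note par = assms(1,2,7,8)
  define b where "b = \<mu> / (2 * L)"
  define V0 where "V0 = f x0 - f xstar + \<mu> / 4 * R\<^sup>2"
  define r where "r = b powr (1 - \<gamma>)"
  have b: "0 < b" and L: "0 < L" using assms(1,2) by (auto simp: b_def)
  have \<gamma>: "0 \<le> \<gamma>" "\<gamma> \<le> 1 / 2" using gamma_star_bounds[OF par] assms(12) by auto
  have V0: "0 \<le> V0" using assms(1,6) by (simp add: V0_def)
  have D: "0 \<le> \<delta>\<^sup>2 / \<mu>" using assms(1) by simp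
  have r: "r = b / b powr \<gamma>" using b by (simp add: r_def powr_diff)
  have inv: "(2 * L / \<mu>) powr \<gamma> = 1 / b powr \<gamma>"
    using powr_divide[of 1 b \<gamma>] b L assms(1) by (simp add: b_def)
  have rate: "1 / 150 * r \<le> omega L \<mu> \<alpha>"
    using step_params(4)[OF par] unfolding r b_def assms(12) .
  have w: "omega L \<mu> \<alpha> \<le> 1" using step_params(1)[OF par] omega_root(1)[OF par] by simp
  have "f (RE_AGM_x g L \<mu> x0 \<alpha> N) - f xstar
    \<le> (1 - omega L \<mu> \<alpha>) ^ N * V0 + ((2 * L / \<mu>) powr \<gamma> + 5) * (\<delta>\<^sup>2 / \<mu>)"
    using RE_AGM_gap_le[OF par assms(4,5,6,10), of x0 N]
    unfolding inv unfolding V0_def b_def assms(11,12) .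
  also have "\<dots> \<le> (1 - 1 / 150 * r) ^ N * V0 + ((2 * L / \<mu>) powr \<gamma> + 5) * (\<delta>\<^sup>2 / \<mu>)"
    using rate w V0 by (intro add_right_mono mult_right_mono power_mono) auto
  finally have first: "f (RE_AGM_x g L \<mu> x0 \<alpha> N) - f xstar
    \<le> (1 - 1 / 150 * r) ^ N * V0 + ((2 * L / \<mu>) powr \<gamma> + 5) * (\<delta>\<^sup>2 / \<mu>)" .
  \<comment> \<open>The second estimate is a weakening of the first: pulling the 2 out of the rate
    and out of the noise term costs a factor of at most 2 each time.\<close>
  have two: "2 powr p \<le> 2" if "p \<le> 1" for p :: real
    using powr_mono[OF that, of 2] by simp
  have "(\<mu> / L) powr (1 - \<gamma>) = 2 powr (1 - \<gamma>) * r"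
    using powr_mult[of 2 b "1 - \<gamma>"] b by (simp add: r_def) (simp add: b_def)
  also have "\<dots> \<le> 2 * r" using two \<gamma> by (intro mult_right_mono) (auto simp: r_def)
  finally have r': "1 / 300 * (\<mu> / L) powr (1 - \<gamma>) \<le> 1 / 150 * r" by simp
  have "(2 * L / \<mu>) powr \<gamma> = 2 powr \<gamma> * (L / \<mu>) powr \<gamma>"
    using powr_mult[of 2 "L / \<mu>" \<gamma>] assms(1) L by simp
  also have "\<dots> \<le> 2 * (L / \<mu>) powr \<gamma>" using two \<gamma> by (intro mult_right_mono) auto
  finally have L': "(2 * L / \<mu>) powr \<gamma> + 5 \<le> 2 * (L / \<mu>) powr \<gamma> + 5" by simp
  note first
  also have "(1 - 1 / 150 * r) ^ N * V0 + ((2 * L / \<mu>) powr \<gamma> + 5) * (\<delta>\<^sup>2 / \<mu>)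
    \<le> (1 - 1 / 300 * (\<mu> / L) powr (1 - \<gamma>)) ^ N * V0 + (2 * (L / \<mu>) powr \<gamma> + 5) * (\<delta>\<^sup>2 / \<mu>)"
    using r' L' rate w V0 D by (intro add_mono mult_right_mono power_mono) auto
  finally show ?thesis using first unfolding V0_def r_def b_def by blast
qed


end
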